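(* Let $(S,v)$ be a normed semigroup whose norm $v$ is subadditive and arithmetic, and let $\phi:S\to S$ be an endomorphism such that $(S,\phi)$ is locally quasi-periodic. Then $h_{\mathfrak S}(\phi)=0$.
   Context: A normed semigroup $(S,v)$ is a semigroup $(S,\cdot)$ with a function $v:S\to\mathbb R_{\ge0}$. Endomorphisms are contractive semigroup endomorphisms: $v(\phi(x))\le v(x)$ for all $x$. The norm is subadditive if $v(x\cdot y)\le v(x)+v(y)$ for all $x,y$; it is arithmetic if for every $x\in S$ there is a positive integer $C_x$ such that $v(x^n)\le C_x\cdot\log n$ for every integer $n\ge2$. The pair $(S,\phi)$ is locally quasi-periodic if for every $x\in S$ there exist natural numbers $m<k$ with $\phi^k(x)=\phi^m(x)$. For $x\in S$, $T_n(\phi,x)=x\cdot\phi(x)\cdots\phi^{n-1}(x)$, $h_{\mathfrak S}(\phi,x)=\limsup_{n\to\infty}\frac{v(T_n(\phi,x))}{n}$, and $h_{\mathfrak S}(\phi)=\sup_{x\in S}h_{\mathfrak S}(\phi,x)\in[0,\infty]$. *)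

theory Defs
  imports Complex_Main "HOL-Library.Extended_Nonnegative_Real"
begin

text \<open>
  A semigroup need not have a unit, so only nonempty products are available:
  \<open>sg_prod f n\<close> is the product \<open>f 0 * f 1 * \<dots> * f n\<close> of \<open>n + 1\<close> factors.
\<close>

primrec sg_prod :: "(nat \<Rightarrow> 'a::semigroup_mult) \<Rightarrow> nat \<Rightarrow> 'a" where
  "sg_prod f 0 = f 0"
| "sg_prod f (Suc n) = sg_prod f n * f (Suc n)"

text \<open>
  The powers \<open>x\<^sup>n\<close> and the products \<open>x * \<phi> x * \<dots> * \<phi>\<^sup>n\<^sup>-\<^sup>1 x\<close> make sense for
  \<open>n \<ge> 1\<close> only; at \<open>n = 0\<close> the functions below take the irrelevant value \<open>x\<close>.
\<close>

definition sg_power :: "'a::semigroup_mult \<Rightarrow> nat \<Rightarrow> 'a" where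
  "sg_power x n = sg_prod (\<lambda>_. x) (n - 1)"

definition sg_trajectory :: "('a::semigroup_mult \<Rightarrow> 'a) \<Rightarrow> nat \<Rightarrow> 'a \<Rightarrow> 'a" where
  "sg_trajectory \<phi> n x = sg_prod (\<lambda>i. (\<phi> ^^ i) x) (n - 1)"

definition sg_norm :: "('a::semigroup_mult \<Rightarrow> real) \<Rightarrow> bool" where
  "sg_norm v \<longleftrightarrow> (\<forall>x. 0 \<le> v x)"

definition subadditive_norm :: "('a::semigroup_mult \<Rightarrow> real) \<Rightarrow> bool" where
  "subadditive_norm v \<longleftrightarrow> (\<forall>x y. v (x * y) \<le> v x + v y)"

definition arithmetic_norm :: "('a::semigroup_mult \<Rightarrow> real) \<Rightarrow> bool" where
  "arithmetic_norm v \<longleftrightarrow>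
     (\<forall>x. \<exists>C::nat. 0 < C \<and> (\<forall>n\<ge>2. v (sg_power x n) \<le> real C * ln (real n)))"

definition normed_sg_endo ::
  "('a::semigroup_mult \<Rightarrow> real) \<Rightarrow> ('a \<Rightarrow> 'a) \<Rightarrow> bool" where
  "normed_sg_endo v \<phi> \<longleftrightarrow>
     (\<forall>x y. \<phi> (x * y) = \<phi> x * \<phi> y) \<and> (\<forall>x. v (\<phi> x) \<le> v x)"

definition locally_quasi_periodic :: "('a \<Rightarrow> 'a) \<Rightarrow> bool" where
  "locally_quasi_periodic \<phi> \<longleftrightarrow>
     (\<forall>x. \<exists>m k::nat. m < k \<and> (\<phi> ^^ k) x = (\<phi> ^^ m) x)"

text \<open>
  Both entropies live in \<open>[0, \<infinity>]\<close>. The coercion \<open>ennreal\<close> loses nothing for a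
  nonnegative \<open>v\<close>, and the term with \<open>n = 0\<close> does not affect the upper limit.
\<close>

definition sg_entropy_at ::
  "('a::semigroup_mult \<Rightarrow> real) \<Rightarrow> ('a \<Rightarrow> 'a) \<Rightarrow> 'a \<Rightarrow> ennreal" where
  "sg_entropy_at v \<phi> x =
     limsup (\<lambda>n. ennreal (v (sg_trajectory \<phi> n x) / real n))"

definition sg_entropy ::
  "('a::semigroup_mult \<Rightarrow> real) \<Rightarrow> ('a \<Rightarrow> 'a) \<Rightarrow> ennreal" where
  "sg_entropy v \<phi> = (SUP x. sg_entropy_at v \<phi> x)"

end

theory Submission
  imports Defs "HOL-Real_Asymp.Real_Asymp"
begin

text \<open>
  An eventually periodic orbit makes the trajectory of \<open>x\<close> a fixed prefix, followed by a power
  \<open>w\<^sup>q\<close> of the product \<open>w\<close> over one period, followed by one of finitely many remainders. By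
  subadditivity its norm is \<open>O(log n)\<close>, hence \<open>o(n)\<close>.
\<close>

lemma sg_prod_add:
  "sg_prod f (Suc (a + b)) = sg_prod f a * sg_prod (\<lambda>i. f (Suc a + i)) b"
  by (induction b) (simp_all add: mult.assoc)

lemma sg_power_Suc_Suc: "sg_power x (Suc (Suc n)) = sg_power x (Suc n) * x"
  by (simp add: sg_power_def)

text \<open>Induction on \<open>q\<close>, with \<open>r\<close> arbitrary so that a further period
  can hide in the remainder: the hypothesis is used at \<open>Suc (p + r)\<close>, and one copy of
  \<open>sg_prod g p\<close> is then split off. The remainder keeps \<open>r + 1\<close> factors, so
  it is never an empty product.\<close>

lemma sg_prod_periodic:
  assumes "\<And>i. g (Suc p + i) = g i"
  shows "sg_prod g (Suc q * Suc p + r) = sg_power (sg_prod g p) (Suc q) * sg_prod g r"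
proof (induction q arbitrary: r)
  case 0
  show ?case using sg_prod_add[of g p r] assms by (simp add: sg_power_def)
next
  case (Suc q)
  have "sg_prod g (Suc (Suc q) * Suc p + r) = sg_prod g (Suc q * Suc p + Suc (p + r))"
    by (simp add: algebra_simps)
  also have "\<dots> = sg_power (sg_prod g p) (Suc q) * (sg_prod g p * sg_prod g r)"
    using sg_prod_add[of g p r] assms by (simp only: Suc.IH)
  finally show ?case by (simp add: sg_power_Suc_Suc mult.assoc)
qed

lemma funpow_quasi_periodic:
  fixes f :: "'a \<Rightarrow> 'a"
  assumes "(f ^^ k) x = (f ^^ m) x"
  shows "(f ^^ (i + k)) x = (f ^^ (i + m)) x"
  using assms by (simp add: funpow_add)

text \<open>\<open>A\<close> covers the prefix and the remainders, and \<open>C\<close> is the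
  arithmetic constant of the product over one period. Both may depend on \<open>x\<close>, but not
  on \<open>n\<close>.\<close>

lemma sg_trajectory_log_bound:
  assumes norm: "sg_norm v" and sub: "subadditive_norm v" and ar: "arithmetic_norm v"
    and lqp: "locally_quasi_periodic \<phi>"
  shows "\<exists>A C. \<forall>\<^sub>F n in sequentially. v (sg_trajectory \<phi> n x) \<le> A + C * ln (real n)"
proof -
  obtain m k where mk: "m < k" "(\<phi> ^^ k) x = (\<phi> ^^ m) x"
    using lqp unfolding locally_quasi_periodic_def by blast
  obtain p where p: "k = m + Suc p"
    using less_imp_Suc_add[OF mk(1)] by auto
  define f where "f i = (\<phi> ^^ i) x" for i
  \<comment> \<open>Starting at \<open>Suc m\<close> instead of \<open>m\<close> leaves the prefix
    \<open>f 0, ..., f m\<close> nonempty even when \<open>m = 0\<close>.\<close>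
  define g where "g i = f (Suc m + i)" for i
  define w where "w = sg_prod g p"
  have per: "g (Suc p + i) = g i" for i
    using funpow_quasi_periodic[OF mk(2), of "Suc i"]
    unfolding g_def f_def p by (simp only: add_Suc add_Suc_right ac_simps)
  obtain C :: nat where C: "\<And>n. n \<ge> 2 \<Longrightarrow> v (sg_power w n) \<le> real C * ln (real n)"
    using ar unfolding arithmetic_norm_def by blast
  \<comment> \<open>As \<open>v\<close> is nonnegative, this sum dominates the norm of each possible
    remainder.\<close>
  define B where "B = (\<Sum>r\<le>p. v (sg_prod g r))"
  \<comment> \<open>The threshold leaves room for two full periods after the prefix, since the
    arithmetic bound holds only for exponents at least 2.\<close>
  have "v (sg_trajectory \<phi> n x) \<le> (v (sg_prod f m) + B) + real C * ln (real n)"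
    if n: "n \<ge> m + 2 + 2 * Suc p" for n
  proof -
    \<comment> \<open>Of the \<open>n\<close> factors, \<open>m + 1\<close> belong to the prefix;
      the other \<open>j + 1\<close> form \<open>sg_prod g j\<close>.\<close>
    define j where "j = n - (m + 2)"
    define q where "q = j div Suc p"
    define r where "r = j mod Suc p"
    have nj: "n - 1 = Suc (m + j)" and jn: "j \<le> n" and j: "2 * Suc p \<le> j"
      using n by (auto simp: j_def)
    have q2: "q \<ge> 2"
      unfolding q_def using j by (simp add: less_eq_div_iff_mult_less_eq)
    then obtain q' where q': "q = Suc q'" by (cases q) auto
    have jq: "j = q * Suc p + r" unfolding q_def r_def by (simp only: div_mult_mod_eq)
    have "q \<le> n" unfolding q_def using jn div_le_dividend le_trans by blast
    then have ln: "ln (real q) \<le> ln (real n)" using q2 by simp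
    have "r \<le> p" unfolding r_def using mod_less_divisor[of "Suc p" j] by linarith
    then have rB: "v (sg_prod g r) \<le> B"
      unfolding B_def using norm by (intro member_le_sum) (auto simp: sg_norm_def)
    have "sg_trajectory \<phi> n x = sg_prod f m * sg_prod g j"
      unfolding sg_trajectory_def nj sg_prod_add g_def f_def ..
    also have "sg_prod g j = sg_power w q * sg_prod g r"
      unfolding jq q' w_def using sg_prod_periodic[of g p] per by blast
    finally have "v (sg_trajectory \<phi> n x)
        \<le> v (sg_prod f m) + (v (sg_power w q) + v (sg_prod g r))"
      using sub unfolding subadditive_norm_def by (metis add_left_mono order_trans)
    also have "\<dots> \<le> v (sg_prod f m) + (real C * ln (real n) + B)"
      using C[OF q2] mult_left_mono[OF ln, of "real C"] rB by linarith
    finally show ?thesis by simp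
  qed
  then show ?thesis unfolding eventually_sequentially by blast
qed

theorem theorem3p17:
  fixes v :: "'a::semigroup_mult \<Rightarrow> real" and \<phi> :: "'a \<Rightarrow> 'a"
  assumes "sg_norm v"
    and "subadditive_norm v"
    and "arithmetic_norm v"
    and "normed_sg_endo v \<phi>"
    and "locally_quasi_periodic \<phi>"
  shows "sg_entropy v \<phi> = 0"
proof -
  have "sg_entropy_at v \<phi> x = 0" for x
  proof -
    \<comment> \<open>No uniformity in \<open>x\<close> is required: the supremum is taken over
      values that are each 0.\<close>
    obtain A C where AC: "\<forall>\<^sub>F n in sequentially. v (sg_trajectory \<phi> n x) \<le> A + C * ln (real n)"
      using sg_trajectory_log_bound assms by blast
    have "(\<lambda>n. v (sg_trajectory \<phi> n x) / real n) \<longlonglongrightarrow> 0"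
    proof (rule tendsto_sandwich)
      show "\<forall>\<^sub>F n in sequentially. 0 \<le> v (sg_trajectory \<phi> n x) / real n"
        using assms(1) by (simp add: sg_norm_def)
      show "\<forall>\<^sub>F n in sequentially. v (sg_trajectory \<phi> n x) / real n \<le> (A + C * ln (real n)) / real n"
        using AC by eventually_elim (simp add: divide_right_mono)
      show "(\<lambda>n. (A + C * ln (real n)) / real n) \<longlonglongrightarrow> 0"
        by real_asymp
    qed simp
    then have "(\<lambda>n. ennreal (v (sg_trajectory \<phi> n x) / real n)) \<longlonglongrightarrow> 0"
      using tendsto_ennrealI by fastforce
    then show ?thesis
      unfolding sg_entropy_at_def by (intro lim_imp_Limsup) simp_all
  qed
  then show ?thesis by (simp add: sg_entropy_def)
qed

end
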